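(* Let $m\ge 1$, $n_1,\dots,n_m\ge 1$, and $\mathbb{X}=\biguplus_{r=1}^{m}\{r\}\times\mathbb{R}^{n_r}$. Suppose the predicted density at time step $k$ is a density on $\mathbb{X}$, $f_{k|k-1}(r_k,x_k)=f_{k|k-1}(r_k)f_{k|k-1}(x_k|r_k)$, with conditional state density of the form $$f_{k|k-1}(x_k|r_k)=\sum_{r_{k-1}=1}^{m}\alpha_{k|k-1}^{(r_k,r_{k-1})}\int_{\mathbb{R}^{n_{r_{k-1}}}}\pi(x_k|x_{k-1},r_k,r_{k-1})f_{k-1|k-1}(x_{k-1}|r_{k-1})\,dx_{k-1},\qquad \alpha_{k|k-1}^{(r_k,r_{k-1})}=\frac{\mu(r_k|r_{k-1})f_{k-1|k-1}(r_{k-1})}{\sum_{r'=1}^{m}\mu(r_k|r')f_{k-1|k-1}(r')},$$ and let $l(z_k|r_k,x_k)$ be the density of the measurement $z_k\in\mathbb{R}^{n_z}$ given $(r_k,x_k)$. Then the posterior density at time step $k$ is $f_{k|k}(r_k,x_k)=f_{k|k}(r_k)f_{k|k}(x_k|r_k)$ with $$f_{k|k}(x_k|r_k)=\frac{l(z_k|r_k,x_k)f_{k|k-1}(x_k|r_k)}{\int_{\mathbb{R}^{n_{r_k}}} l(z_k|r_k,x)f_{k|k-1}(x|r_k)\,dx},$$ $$f_{k|k}(r_k)=\frac{f_{k|k-1}(r_k)\int_{\mathbb{R}^{n_{r_k}}} l(z_k|r_k,x)f_{k|k-1}(x|r_k)\,dx}{\sum_{r=1}^{m}f_{k|k-1}(r)\int_{\mathbb{R}^{n_{r}}}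 l(z_k|r,x)f_{k|k-1}(x|r)\,dx}.$$
   Context: The target state is $\tilde x=(r,x)\in\mathbb{X}$ with mode $r\in\{1,\dots,m\}$ and kinematic state $x\in\mathbb{R}^{n_r}$; the dimensions $n_r$ may differ between modes. The integral of a real-valued function $g$ on $\mathbb{X}$ is $\int_{\mathbb{X}}g(\tilde x)\,d\tilde x=\sum_{r=1}^m\int_{\mathbb{R}^{n_r}}g(r,x)\,dx$. A density on $\mathbb{X}$ is a nonnegative function with integral one. For a density $g$ on $\mathbb{X}$, $g(r)=\int_{\mathbb{R}^{n_r}}g(r,x)\,dx$ is the marginal (probability mass function) of the mode and $g(x|r)=g(r,x)/g(r)$ is the conditional density on $\mathbb{R}^{n_r}$ of the state given the mode; identities involving quantities conditioned on $r$ are asserted for those $r$ with $g(r)>0$, and all denominators are assumed positive. Here $f_{k-1|k-1}(r_{k-1},x_{k-1})=f_{k-1|k-1}(r_{k-1})f_{k-1|k-1}(x_{k-1}|r_{k-1})$ is the posterior density on $\mathbb{X}$ at time $k-1$; $\mu(\cdot|r_{k-1})$ is a probability mass function on $\{1,\dots,m\}$ (mode transition); $\pi(\cdot|x_{k-1},r_k,r_{k-1})$ is a probability density on $\mathbb{R}^{n_{r_k}}$ (state transition given the modes). The posterior density is defined by Bayes' rule on $\mathbb{X}$: $f_{k|k}(\tilde x_k)=\dfrac{l(z_k|\tilde x_k)f_{k|k-1}(\tilde x_k)}{\int_{\mathbb{X}}l(z_k|\tilde x)f_{k|k-1}(\tilde x)\,d\tilde x}$. *)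

theory Defs
  imports "HOL-Probability.Probability"
begin

text \<open>
  The dimension of the kinematic state depends on the mode, so a vector of dimension \<open>d\<close> is an
  extensional function on the index set \<open>{..<d}\<close>, and \<open>Rn d\<close> carries the \<open>d\<close>-fold product of
  Lebesgue measure.
\<close>

definition Rn :: "nat \<Rightarrow> (nat \<Rightarrow> real) measure" where
  "Rn d = (\<Pi>\<^sub>M i\<in>{..<d}. lborel)"

type_synonym hybrid_state = "nat \<times> (nat \<Rightarrow> real)"

definition hybrid_space :: "nat \<Rightarrow> (nat \<Rightarrow> nat) \<Rightarrow> hybrid_state set" where
  "hybrid_space m n = (SIGMA r:{1..m}. space (Rn (n r)))"

definition hybrid_integrable :: "nat \<Rightarrow> (nat \<Rightarrow> nat) \<Rightarrow> (hybrid_state \<Rightarrow> real) \<Rightarrow> bool" where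
  "hybrid_integrable m n g \<longleftrightarrow> (\<forall>r\<in>{1..m}. integrable (Rn (n r)) (\<lambda>x. g (r, x)))"

definition hybrid_integral :: "nat \<Rightarrow> (nat \<Rightarrow> nat) \<Rightarrow> (hybrid_state \<Rightarrow> real) \<Rightarrow> real" where
  "hybrid_integral m n g = (\<Sum>r=1..m. \<integral>x. g (r, x) \<partial>Rn (n r))"

text \<open>
  Integrability is part of being a density because the Bochner integral of a
  non-integrable function is \<open>0\<close>.
\<close>

definition Rn_density :: "nat \<Rightarrow> ((nat \<Rightarrow> real) \<Rightarrow> real) \<Rightarrow> bool" where
  "Rn_density d p \<longleftrightarrow>
     (\<forall>x\<in>space (Rn d). 0 \<le> p x) \<and> integrable (Rn d) p \<and> (\<integral>x. p x \<partial>Rn d) = 1"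

definition hybrid_density :: "nat \<Rightarrow> (nat \<Rightarrow> nat) \<Rightarrow> (hybrid_state \<Rightarrow> real) \<Rightarrow> bool" where
  "hybrid_density m n g \<longleftrightarrow>
     (\<forall>\<xi>\<in>hybrid_space m n. 0 \<le> g \<xi>) \<and> hybrid_integrable m n g \<and> hybrid_integral m n g = 1"

definition mode_marginal :: "(nat \<Rightarrow> nat) \<Rightarrow> (hybrid_state \<Rightarrow> real) \<Rightarrow> nat \<Rightarrow> real" where
  "mode_marginal n g r = (\<integral>x. g (r, x) \<partial>Rn (n r))"

text \<open>Only meaningful for modes with positive marginal; otherwise it is \<open>0\<close>.\<close>

definition state_given_mode ::
  "(nat \<Rightarrow> nat) \<Rightarrow> (hybrid_state \<Rightarrow> real) \<Rightarrow> nat \<Rightarrow> (nat \<Rightarrow> real) \<Rightarrow> real" where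
  "state_given_mode n g r x = g (r, x) / mode_marginal n g r"

text \<open>
  \<open>mixing_weight m n \<mu> f r r'\<close> is the probability that the previous mode was \<open>r'\<close> given that the
  current mode is \<open>r\<close>; here \<open>pmf (\<mu> r') r\<close> is the probability of a transition from \<open>r'\<close> to \<open>r\<close>.
\<close>

definition mixing_weight ::
  "nat \<Rightarrow> (nat \<Rightarrow> nat) \<Rightarrow> (nat \<Rightarrow> nat pmf) \<Rightarrow> (hybrid_state \<Rightarrow> real) \<Rightarrow> nat \<Rightarrow> nat \<Rightarrow> real" where
  "mixing_weight m n \<mu> f r r' =
     pmf (\<mu> r') r * mode_marginal n f r' / (\<Sum>s=1..m. pmf (\<mu> s) r * mode_marginal n f s)"

definition bayes_posterior ::
  "nat \<Rightarrow> (nat \<Rightarrow> nat) \<Rightarrow> (hybrid_state \<Rightarrow> real) \<Rightarrow> (hybrid_state \<Rightarrow> real) \<Rightarrow> hybrid_state \<Rightarrow> real" where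
  "bayes_posterior m n lik f \<xi> = lik \<xi> * f \<xi> / hybrid_integral m n (\<lambda>\<xi>'. lik \<xi>' * f \<xi>')"

end

theory Submission
  imports Defs
begin

lemma hybrid_density_nonneg:
  assumes "hybrid_density m n f" "r \<in> {1..m}" "x \<in> space (Rn (n r))"
  shows "0 \<le> f (r, x)"
  using assms by (auto simp: hybrid_density_def hybrid_space_def)

text \<open>
  If the marginal of \<open>r\<close> vanishes, the right-hand side is \<open>0\<close>, and so is the left-hand side because
  \<open>f (r, \<cdot>)\<close> is then zero almost everywhere.
\<close>

lemma integral_mult_eq_mode_marginal_mult:
  assumes "hybrid_density m n f" "r \<in> {1..m}"
  shows "(\<integral>x. g x * f (r, x) \<partial>Rn (n r)) =
    mode_marginal n f r * (\<integral>x. g x * state_given_mode n f r x \<partial>Rn (n r))"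
proof (cases "mode_marginal n f r = 0")
  case True
  have "integrable (Rn (n r)) (\<lambda>x. f (r, x))"
    using assms by (simp add: hybrid_density_def hybrid_integrable_def)
  moreover have "AE x in Rn (n r). 0 \<le> f (r, x)"
    by (rule AE_I2) (rule hybrid_density_nonneg[OF assms])
  ultimately have "AE x in Rn (n r). f (r, x) = 0"
    using True integral_nonneg_eq_0_iff_AE unfolding mode_marginal_def by blast
  then have "AE x in Rn (n r). g x * f (r, x) = 0"
    by eventually_elim simp
  then show ?thesis
    using True by (simp add: integral_eq_zero_AE)
next
  case False
  \<comment> \<open>The constant marginal leaves the integral and cancels. This is valid for every
    \<open>g\<close>: a nonzero constant factor does not affect integrability, and in the
    non-integrable case both integrals are \<open>0\<close>.\<close>
  then show ?thesis
    by (simp add: state_given_mode_def)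
qed

text \<open>Law of total probability over the modes. Applied to a likelihood \<open>g\<close>, it
  turns the denominator of Bayes' rule into the normalising sum of the mode update.\<close>

lemma hybrid_integral_mult_eq_sum:
  assumes "hybrid_density m n f"
  shows "hybrid_integral m n (\<lambda>\<xi>. g \<xi> * f \<xi>) =
    (\<Sum>r=1..m. mode_marginal n f r * (\<integral>x. g (r, x) * state_given_mode n f r x \<partial>Rn (n r)))"
  unfolding hybrid_integral_def
  by (intro sum.cong refl integral_mult_eq_mode_marginal_mult[OF assms])

lemma mode_marginal_bayes_posterior:
  "mode_marginal n (bayes_posterior m n lik f) r =
    (\<integral>x. lik (r, x) * f (r, x) \<partial>Rn (n r)) / hybrid_integral m n (\<lambda>\<xi>. lik \<xi> * f \<xi>)"
  by (simp add: mode_marginal_def bayes_posterior_def)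

text \<open>Dividing by a positive normalising constant. A likelihood may be unbounded in the state,
  so integrability of the product is assumed separately.\<close>

lemma hybrid_density_bayes_posterior:
  assumes "\<And>\<xi>. \<xi> \<in> hybrid_space m n \<Longrightarrow> 0 \<le> lik \<xi>"
    and "\<And>\<xi>. \<xi> \<in> hybrid_space m n \<Longrightarrow> 0 \<le> f \<xi>"
    and "hybrid_integrable m n (\<lambda>\<xi>. lik \<xi> * f \<xi>)"
    and "hybrid_integral m n (\<lambda>\<xi>. lik \<xi> * f \<xi>) > 0"
  shows "hybrid_density m n (bayes_posterior m n lik f)"
  unfolding hybrid_density_def
proof (intro conjI ballI)
  show "0 \<le> bayes_posterior m n lik f \<xi>" if "\<xi> \<in> hybrid_space m n" for \<xi>
    using assms that by (simp add: bayes_posterior_def)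
  show "hybrid_integrable m n (bayes_posterior m n lik f)"
    using assms(3) by (simp add: hybrid_integrable_def bayes_posterior_def)
  have "hybrid_integral m n (bayes_posterior m n lik f) =
      hybrid_integral m n (\<lambda>\<xi>. lik \<xi> * f \<xi>) / hybrid_integral m n (\<lambda>\<xi>. lik \<xi> * f \<xi>)"
    \<comment> \<open>Only the left-hand side and the numerator are unfolded; the denominator stays
      folded to match the constant inside \<open>bayes_posterior\<close>.\<close>
    by (subst (1 2) hybrid_integral_def) (simp add: bayes_posterior_def sum_divide_distrib)
  then show "hybrid_integral m n (bayes_posterior m n lik f) = 1"
    using assms(4) by simp
qed

text \<open>The evidence cancels between the posterior and its marginal, and the prior mass of
  \<open>r\<close> is absorbed into the conditional prior: Bayes' rule within one mode.\<close>

lemma state_given_mode_bayes_posterior: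
  assumes "hybrid_density m n f" "r \<in> {1..m}"
    and "mode_marginal n (bayes_posterior m n lik f) r \<noteq> 0"
  shows "state_given_mode n (bayes_posterior m n lik f) r x =
    lik (r, x) * state_given_mode n f r x /
    (\<integral>y. lik (r, y) * state_given_mode n f r y \<partial>Rn (n r))"
proof -
  \<comment> \<open>\<open>K\<close> is the likelihood of the measurement under mode
    \<open>r\<close> alone, \<open>D\<close> the evidence over all modes.\<close>
  define K where "K = (\<integral>y. lik (r, y) * state_given_mode n f r y \<partial>Rn (n r))"
  define D where "D = hybrid_integral m n (\<lambda>\<xi>. lik \<xi> * f \<xi>)"
  have marg: "mode_marginal n (bayes_posterior m n lik f) r = mode_marginal n f r * K / D"
    unfolding mode_marginal_bayes_posterior K_def D_def
    by (simp only: integral_mult_eq_mode_marginal_mult[OF assms(1,2)])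
  \<comment> \<open>As \<open>x / 0 = 0\<close>, a nonzero value of the quotient in
    \<open>marg\<close> forces all three quantities to be nonzero.\<close>
  with assms(3) have "mode_marginal n f r \<noteq> 0" "K \<noteq> 0" "D \<noteq> 0"
    by auto
  moreover have "bayes_posterior m n lik f (r, x) = lik (r, x) * f (r, x) / D"
    by (simp add: bayes_posterior_def D_def)
  ultimately show ?thesis
    \<comment> \<open>Fixing \<open>x\<close> keeps the conditional density under the integral
      folded, so that the integral is still recognised as \<open>K\<close>.\<close>
    by (simp add: state_given_mode_def[where r = r and x = x] marg flip: K_def)
qed

theorem lemma2:
  fixes m nz :: nat and n :: "nat \<Rightarrow> nat"
    and f_prev f_pred f_post :: "hybrid_state \<Rightarrow> real"
    and \<mu> :: "nat \<Rightarrow> nat pmf"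
    and \<pi> :: "(nat \<Rightarrow> real) \<Rightarrow> (nat \<Rightarrow> real) \<Rightarrow> nat \<Rightarrow> nat \<Rightarrow> real"
    and l :: "(nat \<Rightarrow> real) \<Rightarrow> hybrid_state \<Rightarrow> real"
    and z :: "nat \<Rightarrow> real"
  assumes "m \<ge> 1"
    and "\<And>r. r \<in> {1..m} \<Longrightarrow> n r \<ge> 1"
    and prev_density: "hybrid_density m n f_prev"
    and mode_transition: "\<And>r'. r' \<in> {1..m} \<Longrightarrow> set_pmf (\<mu> r') \<subseteq> {1..m}"
    and state_transition: "\<And>r r' x'. r \<in> {1..m} \<Longrightarrow> r' \<in> {1..m} \<Longrightarrow> x' \<in> space (Rn (n r')) \<Longrightarrow>
          Rn_density (n r) (\<lambda>x. \<pi> x x' r r')"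
    and pred_density: "hybrid_density m n f_pred"
    and weight_denominator: "\<And>r. r \<in> {1..m} \<Longrightarrow> mode_marginal n f_pred r > 0 \<Longrightarrow>
          (\<Sum>s=1..m. pmf (\<mu> s) r * mode_marginal n f_prev s) > 0"
    and pred_form: "\<And>r x. r \<in> {1..m} \<Longrightarrow> mode_marginal n f_pred r > 0 \<Longrightarrow> x \<in> space (Rn (n r)) \<Longrightarrow>
          state_given_mode n f_pred r x =
            (\<Sum>r'=1..m. mixing_weight m n \<mu> f_prev r r' *
               (\<integral>x'. \<pi> x x' r r' * state_given_mode n f_prev r' x' \<partial>Rn (n r')))"
    and likelihood: "\<And>\<xi>. \<xi> \<in> hybrid_space m n \<Longrightarrow> Rn_density nz (\<lambda>z'. l z' \<xi>)"
    and measurement: "z \<in> space (Rn nz)"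
    and bayes_integrable: "hybrid_integrable m n (\<lambda>\<xi>. l z \<xi> * f_pred \<xi>)"
    and bayes_denominator: "hybrid_integral m n (\<lambda>\<xi>. l z \<xi> * f_pred \<xi>) > 0"
    and posterior: "f_post = bayes_posterior m n (l z) f_pred"
  shows "hybrid_density m n f_post \<and>
    (\<forall>r\<in>{1..m}. mode_marginal n f_post r > 0 \<longrightarrow>
       (\<forall>x\<in>space (Rn (n r)).
          f_post (r, x) = mode_marginal n f_post r * state_given_mode n f_post r x \<and>
          state_given_mode n f_post r x =
            l z (r, x) * state_given_mode n f_pred r x /
            (\<integral>y. l z (r, y) * state_given_mode n f_pred r y \<partial>Rn (n r)))) \<and>
    (\<forall>r\<in>{1..m}.
       mode_marginal n f_post r =
         mode_marginal n f_pred r *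
           (\<integral>y. l z (r, y) * state_given_mode n f_pred r y \<partial>Rn (n r)) /
         (\<Sum>s=1..m. mode_marginal n f_pred s *
            (\<integral>y. l z (s, y) * state_given_mode n f_pred s y \<partial>Rn (n s))))"
proof (intro conjI ballI impI)
  \<comment> \<open>\<open>l\<close> is a density in the measurement for each fixed state; its sign
    at the observed \<open>z\<close> is what the posterior inherits.\<close>
  have lik_nonneg: "0 \<le> l z \<xi>" if "\<xi> \<in> hybrid_space m n" for \<xi>
    using likelihood[OF that] measurement by (simp add: Rn_density_def)
  show "hybrid_density m n f_post"
    unfolding posterior using lik_nonneg pred_density bayes_integrable bayes_denominator
    by (intro hybrid_density_bayes_posterior) (auto simp: hybrid_density_def)
next
  fix r x
  assume r: "r \<in> {1..m}" and pos: "mode_marginal n f_post r > 0"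
  \<comment> \<open>At marginal \<open>0\<close> the right-hand side would be \<open>0\<close>,
    whereas \<open>f_post\<close> would vanish only almost everywhere; hence
    \<open>pos\<close>.\<close>
  show "f_post (r, x) = mode_marginal n f_post r * state_given_mode n f_post r x"
    using pos by (simp add: state_given_mode_def)
  show "state_given_mode n f_post r x =
      l z (r, x) * state_given_mode n f_pred r x /
      (\<integral>y. l z (r, y) * state_given_mode n f_pred r y \<partial>Rn (n r))"
    using pos unfolding posterior
    by (intro state_given_mode_bayes_posterior[OF pred_density r]) simp
next
  fix r
  assume "r \<in> {1..m}"
  \<comment> \<open>Numerator and denominator factor mode by mode, including modes of zero mass, so
    no positivity of a marginal enters.\<close>
  then show "mode_marginal n f_post r =
      mode_marginal n f_pred r *
        (\<integral>y. l z (r, y) * state_given_mode n f_pred r y \<partial>Rn (n r)) /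
      (\<Sum>s=1..m. mode_marginal n f_pred s *
         (\<integral>y. l z (s, y) * state_given_mode n f_pred s y \<partial>Rn (n s)))"
    unfolding posterior mode_marginal_bayes_posterior
    by (simp only: hybrid_integral_mult_eq_sum[OF pred_density]
        integral_mult_eq_mode_marginal_mult[OF pred_density])
qed

end
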